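(* Let $m>n\ge 1$, $A\in\mathbb{R}^{m\times n}$, $b\in\mathbb{R}^m$ satisfy $0<\sigma_{n+1}<\hat\sigma_n$, and let $x$ be the TLS solution. Let $U^T[A\ \,b]V=\mathrm{diag}(\sigma_1,\ldots,\sigma_{n+1})$ be the (thin) SVD of $[A\ \,b]$ with $V=[v_1,\ldots,v_{n+1}]$, and denote by $V_{11}=V(1:n,1:n)$ the leading $n\times n$ principal submatrix of $V$. Then $$\kappa_g(A,b)=\sqrt{\|x\|^2+1}\;\|V_{11}^{-T}S\|,$$ where $S=\mathrm{diag}([s_1,\ldots,s_n])$ and $s_i=\frac{\sqrt{\sigma_i^2+\sigma_{n+1}^2}}{\sigma_i^2-\sigma_{n+1}^2}$, $i=1,\ldots,n$.
   Context: $\|\cdot\|$ is the Euclidean norm for vectors and the spectral norm for matrices; $\|\cdot\|_F$ is the Frobenius norm. $\hat\sigma_1\ge\cdots\ge\hat\sigma_n$ are the singular values of $A$ and $\sigma_1\ge\cdots\ge\sigma_{n+1}$ are the singular values of $[A\ \,b]\in\mathbb{R}^{m\times(n+1)}$; in the thin SVD, $U\in\mathbb{R}^{m\times(n+1)}$, $U^TU=I_{n+1}$, $V\in\mathbb{R}^{(n+1)\times(n+1)}$, $V^TV=I_{n+1}$. The total least squares (TLS) problem is $\min\|[E\ \,r]\|_F$ subject to $b-r\in\mathcal{R}(A+E)$ ($\mathcal R$ = range); under $\sigma_{n+1}<\hat\sigma_n$ its unique solution is $x=(A^TA-\sigma_{n+1}^2I_n)^{-1}A^Tb$. Absolute condition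 number: for $(\tilde A,\tilde b)$ in a small neighbourhood of $(A,b)$, let $\tilde\sigma_{n+1}$ be the smallest singular value of $[\tilde A\ \,\tilde b]$ and let $g:\mathbb{R}^{m(n+1)}\to\mathbb{R}^n$ be the map $[\mathrm{vec}(\tilde A)^T,\tilde b^T]^T\mapsto(\tilde A^T\tilde A-\tilde\sigma_{n+1}^2I_n)^{-1}\tilde A^T\tilde b$, i.e. the TLS solution map, where $\mathrm{vec}$ stacks columns. Then $\kappa_g(A,b):=\|g'([\mathrm{vec}(A)^T,b^T]^T)\|$, the spectral norm of the derivative of $g$ at $(A,b)$. *)

theory Defs
  imports "HOL-Analysis.Analysis"
begin

(* The indices 1, ..., n are the elements of a finite linearly ordered type 'n, and
   1, ..., n+1 are the elements of 'n option, with None as the last index n+1. *)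

text \<open>The matrix \<open>[A b]\<close>. The library norm on \<open>real^'k^'m\<close> is the Frobenius norm.\<close>

definition augment :: "real^'n^'m \<Rightarrow> real^'m \<Rightarrow> real^('n option)^'m" where
  "augment A b = (\<chi> i j. case j of None \<Rightarrow> b $ i | Some k \<Rightarrow> A $ i $ k)"

definition diag_matrix :: "('k \<Rightarrow> real) \<Rightarrow> real^'k^'k" where
  "diag_matrix d = (\<chi> i j. if i = j then d i else 0)"

definition leading_block :: "real^('n option)^('n option) \<Rightarrow> real^'n^'n" where
  "leading_block V = (\<chi> i j. V $ Some i $ Some j)"

definition spectral_norm :: "real^'k^'m \<Rightarrow> real" where
  "spectral_norm M = onorm ((*v) M)"

(* Only used for matrices with at least as many rows as columns; for a wide matrix this
   set would also contain the zeros contributed by the kernel. *)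
definition singular_values :: "real^'k^'m \<Rightarrow> real set" where
  "singular_values M =
     {s. 0 \<le> s \<and> (\<exists>v. v \<noteq> 0 \<and> (transpose M ** M) *v v = s\<^sup>2 *\<^sub>R v)}"

definition min_singular_value :: "real^'k^'m \<Rightarrow> real" where
  "min_singular_value M = Min (singular_values M)"

(* The factorization M = U * Sigma * V^T is required, rather than only U^T * M * V = Sigma:
   when U is not square, the latter does not by itself force the diagonal entries to be
   the singular values of M. *)
definition thin_svd ::
  "real^('n::{finite,linorder} option)^'m \<Rightarrow> real^('n option)^'m \<Rightarrow> ('n option \<Rightarrow> real) \<Rightarrow>
   real^('n option)^('n option) \<Rightarrow> bool" where
  "thin_svd M U \<sigma> V \<longleftrightarrow>
     transpose U ** U = mat 1 \<and> transpose V ** V = mat 1 \<and>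
     M = U ** diag_matrix \<sigma> ** transpose V \<and>
     (\<forall>i j. i \<le> j \<longrightarrow> \<sigma> (Some j) \<le> \<sigma> (Some i)) \<and>
     (\<forall>i. \<sigma> None \<le> \<sigma> (Some i)) \<and> 0 \<le> \<sigma> None"

lemma thin_svd_diagonalizes:
  assumes "thin_svd M U \<sigma> V"
  shows "transpose U ** M ** V = diag_matrix \<sigma>"
proof -
  have U: "transpose U ** U = mat 1" and V: "transpose V ** V = mat 1"
    and M: "M = U ** diag_matrix \<sigma> ** transpose V"
    using assms by (simp_all add: thin_svd_def)
  have "transpose U ** M ** V
      = (transpose U ** U) ** diag_matrix \<sigma> ** (transpose V ** V)"
    by (simp add: M matrix_mul_assoc)
  then show ?thesis
    by (simp only: U V matrix_mul_lid matrix_mul_rid)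
qed

definition tls_feasible ::
  "real^'n^'m \<Rightarrow> real^'m \<Rightarrow> real^'n^'m \<Rightarrow> real^'m \<Rightarrow> bool" where
  "tls_feasible A b E r \<longleftrightarrow> b - r \<in> range ((*v) (A + E))"

definition tls_solution :: "real^'n^'m \<Rightarrow> real^'m \<Rightarrow> real^'n \<Rightarrow> bool" where
  "tls_solution A b x \<longleftrightarrow>
     (\<exists>E r. tls_feasible A b E r \<and>
            (\<forall>E' r'. tls_feasible A b E' r' \<longrightarrow> norm (augment E r) \<le> norm (augment E' r')) \<and>
            (A + E) *v x = b - r)"

text \<open>
  The identification of \<open>(A, b)\<close> with the vector \<open>[vec(A)\<^sup>T, b\<^sup>T]\<^sup>T\<close>: coordinate
  \<open>Inl (j, i)\<close> is entry \<open>i\<close> of column \<open>j\<close> of \<open>A\<close>, and \<open>Inr i\<close> is entry \<open>i\<close> of \<open>b\<close>.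
\<close>

definition vec_data :: "real^('n::finite)^('m::finite) \<Rightarrow> real^'m \<Rightarrow> real^(('n::finite) \<times> ('m::finite) + 'm)" where
  "vec_data A b = (\<chi> k. case k of Inl (j, i) \<Rightarrow> A $ i $ j | Inr i \<Rightarrow> b $ i)"

definition mat_part :: "real^(('n::finite) \<times> ('m::finite) + 'm) \<Rightarrow> real^'n^'m" where
  "mat_part z = (\<chi> i j. z $ Inl (j, i))"

definition rhs_part :: "real^(('n::finite) \<times> ('m::finite) + 'm) \<Rightarrow> real^'m" where
  "rhs_part z = (\<chi> i. z $ Inr i)"

lemma mat_part_vec_data [simp]: "mat_part (vec_data A b) = A"
  by (simp add: mat_part_def vec_data_def vec_eq_iff)

lemma rhs_part_vec_data [simp]: "rhs_part (vec_data A b) = b"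
  by (simp add: rhs_part_def vec_data_def vec_eq_iff)

definition tls_formula :: "real^'n^'m \<Rightarrow> real^'m \<Rightarrow> real^'n" where
  "tls_formula A b =
     matrix_inv (transpose A ** A - (min_singular_value (augment A b))\<^sup>2 *\<^sub>R mat 1)
       *v (transpose A *v b)"

(* Meaningful only where the inverted matrix is nonsingular; this holds in a neighbourhood
   of any data with min_singular_value (augment A b) < min_singular_value A. *)
definition tls_map :: "real^(('n::finite) \<times> ('m::finite) + 'm) \<Rightarrow> real^'n" where
  "tls_map z = tls_formula (mat_part z) (rhs_part z)"

definition tls_cond :: "real^'n^'m \<Rightarrow> real^'m \<Rightarrow> real" where
  "tls_cond A b = spectral_norm (jacobian tls_map (at (vec_data A b)))"

end

(* Write lambda for the squared least singular value of [A b], P = A^T A - lambda I, z = (x, -1) and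
   r = A x - b. Then z is an eigenvector of [A b]^T [A b] for lambda, so d lambda = 2 <r, [dA db] z> / |z|^2,
   and differentiating P x = A^T b gives dx = P^(-1) (d lambda x - dA^T r - A^T [dA db] z). The adjoint
   of this map sends y = P w to a sum of two rank-one matrices, whose squared Frobenius norm collapses to
   |z|^2 (|A w|^2 + lambda |w|^2 - 2 lambda <x, w>^2 / |z|^2). In the basis of the right singular vectors the
   last term cancels the contribution of v_(n+1) = +- z / |z|, leaving
   |z|^2 sum_i (sigma_i^2 + lambda) (V11^T w)_i^2, while P = V11 diag(sigma_i^2 - lambda) V11^T. *)

theory Submission
  imports Defs
begin

subsection \<open>The least singular value\<close>

text \<open>The least singular value is defined as a minimum over a set, so its smoothness has to be
  earned. Invertibility of P supplies it: it makes lambda a simple eigenvalue of [A b]^T [A b], with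
  eigenvector (x, -1), and it persists for nearby data. Both lambda and x then equal, near the given
  data, their old value plus a product of a continuous factor with a differentiable factor that
  vanishes at the given data, and such a product is differentiable there. The solution x of the
  theorem is given as a minimiser, not by the formula; the variational description of the least
  singular value shows that (x, -1) is an eigenvector, which identifies the two. The same simplicity
  forces v_(n+1) to be parallel to (x, -1); its sign stays open, but only products of two of its
  components occur.\<close>

lemma inner_transpose_mult:
  fixes A :: "real^'n^'m"
  shows "(transpose A *v x) \<bullet> y = x \<bullet> (A *v y)"
  by (simp add: dot_lmul_matrix)

lemma gram_mult:
  fixes M :: "real^'k^'m"
  shows "(transpose M ** M) *v v = transpose M *v (M *v v)"
  by (rule matrix_vector_mul_assoc [symmetric])

text \<open>Cauchy-Schwarz in each row. As \<open>norm M\<close> is the Frobenius norm, this is the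
  bound that compares the cost of a TLS correction with its effect on a vector.\<close>

lemma norm_matrix_vector_le:
  fixes M :: "real^'k^'m"
  shows "norm (M *v v) \<le> norm M * norm v"
proof (rule power2_le_imp_le)
  have "(norm (M *v v))\<^sup>2 = (\<Sum>i\<in>UNIV. ((M $ i) \<bullet> v)\<^sup>2)"
    by (simp add: norm_vec_def L2_set_def sum_nonneg matrix_vector_mul_component)
  also have "\<dots> \<le> (\<Sum>i\<in>UNIV. (norm (M $ i))\<^sup>2 * (norm v)\<^sup>2)"
    by (intro sum_mono) (metis Cauchy_Schwarz_ineq2 abs_ge_zero power2_abs power_mono power_mult_distrib)
  also have "\<dots> = (norm M * norm v)\<^sup>2"
    by (simp add: norm_vec_def [of M] L2_set_def sum_nonneg power_mult_distrib sum_distrib_right)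
  finally show "(norm (M *v v))\<^sup>2 \<le> (norm M * norm v)\<^sup>2" .
qed simp

lemma matrix_inv_left_right:
  fixes A :: "real^'n^'n"
  assumes "invertible A"
  shows "A ** matrix_inv A = mat 1" "matrix_inv A ** A = mat 1"
  using someI_ex [OF assms [unfolded invertible_def]] by (simp_all add: matrix_inv_def)

lemma matrix_inv_mult_eq:
  fixes A :: "real^'n^'n"
  assumes "invertible A"
  shows "matrix_inv A *v y = w \<longleftrightarrow> A *v w = y"
proof
  show "A *v w = y" if "matrix_inv A *v y = w"
    using that matrix_inv_left_right(1) [OF assms] by (metis matrix_vector_mul_assoc matrix_vector_mul_lid)
  show "matrix_inv A *v y = w" if "A *v w = y"
    using that matrix_inv_left_right(2) [OF assms] by (metis matrix_vector_mul_assoc matrix_vector_mul_lid)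
qed

lemma invertible_iff_ker:
  fixes A :: "real^'n^'n"
  shows "invertible A \<longleftrightarrow> (\<forall>x. A *v x = 0 \<longrightarrow> x = 0)"
  by (simp add: invertible_left_inverse matrix_left_invertible_ker)

text \<open>Eigenvectors of the symmetric Gram matrix for distinct eigenvalues are orthogonal, hence
  independent. Finiteness is what gives \<open>Min\<close> in \<open>min_singular_value\<close> its
  meaning.\<close>

lemma finite_singular_values:
  fixes M :: "real^'k^'m"
  shows "finite (singular_values M)"
proof -
  define e where "e s = (SOME v. v \<noteq> 0 \<and> (transpose M ** M) *v v = s\<^sup>2 *\<^sub>R v)" for s :: real
  have e: "e s \<noteq> 0" "(transpose M ** M) *v e s = s\<^sup>2 *\<^sub>R e s" if "s \<in> singular_values M" for s
    using someI_ex [of "\<lambda>v. v \<noteq> 0 \<and> (transpose M ** M) *v v = s\<^sup>2 *\<^sub>R v"] that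
    by (auto simp: e_def singular_values_def)
  have orth: "e s \<bullet> e t = 0" if st: "s \<in> singular_values M" "t \<in> singular_values M" "s \<noteq> t" for s t
  proof -
    have "s\<^sup>2 * (e s \<bullet> e t) = ((transpose M ** M) *v e s) \<bullet> e t"
      using e(2) [OF st(1)] by simp
    also have "\<dots> = e s \<bullet> ((transpose M ** M) *v e t)"
      by (metis gram_mult inner_commute inner_transpose_mult)
    also have "\<dots> = t\<^sup>2 * (e s \<bullet> e t)"
      using e(2) [OF st(2)] by simp
    finally have "(s\<^sup>2 - t\<^sup>2) * (e s \<bullet> e t) = 0"
      by (simp add: algebra_simps)
    moreover have "s\<^sup>2 \<noteq> t\<^sup>2"
      using st by (auto simp: singular_values_def power2_eq_iff_nonneg)
    ultimately show ?thesis by simp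
  qed
  have inj: "inj_on e (singular_values M)"
    by (rule inj_onI) (metis e(1) inner_eq_zero_iff orth)
  have "independent (e ` singular_values M)"
    by (rule pairwise_orthogonal_independent)
      (use e(1) orth in \<open>auto simp: pairwise_def orthogonal_def\<close>)
  then have "finite (e ` singular_values M)"
    by (rule independent_imp_finite)
  then show ?thesis
    using inj by (rule finite_imageD)
qed

lemma norm_add_scaleR_power2:
  fixes a b :: "'a::real_inner"
  shows "(norm (a + t *\<^sub>R b))\<^sup>2 = (norm a)\<^sup>2 + 2 * t * (a \<bullet> b) + t\<^sup>2 * (norm b)\<^sup>2"
  unfolding power2_norm_eq_inner
  by (simp add: inner_add_left inner_add_right inner_commute power2_eq_square algebra_simps)

text \<open>The quadratic form |M w|^2 - c^2 |w|^2 is nonnegative and vanishes at \<open>v\<close>,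
  so its gradient at \<open>v\<close>, which is twice \<open>u\<close>, must vanish. The variation
  is taken in the direction \<open>u\<close> itself.\<close>

lemma minimizer_imp_eigenvector:
  fixes M :: "real^'k^'m"
  assumes c: "0 \<le> c" and low: "\<And>w. c * norm w \<le> norm (M *v w)"
    and v: "norm (M *v v) \<le> c * norm v"
  shows "(transpose M ** M) *v v = c\<^sup>2 *\<^sub>R v"
proof -
  define u where "u = (transpose M ** M) *v v - c\<^sup>2 *\<^sub>R v"
  define K where "K = (norm (M *v u))\<^sup>2 - c\<^sup>2 * (norm u)\<^sup>2"
  have v_eq: "(norm (M *v v))\<^sup>2 = c\<^sup>2 * (norm v)\<^sup>2"
    using antisym [OF v low] by (simp add: power_mult_distrib)
  have uu: "(M *v v) \<bullet> (M *v u) - c\<^sup>2 * (v \<bullet> u) = u \<bullet> u"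
    by (simp add: u_def gram_mult inner_transpose_mult inner_diff_left
        del: transpose_matrix_vector)
  have K: "0 \<le> 2 * t * (u \<bullet> u) + t\<^sup>2 * K" for t
  proof -
    have "(c * norm (v + t *\<^sub>R u))\<^sup>2 \<le> (norm (M *v (v + t *\<^sub>R u)))\<^sup>2"
      using c low by (intro power_mono) auto
    then have "c\<^sup>2 * (norm (v + t *\<^sub>R u))\<^sup>2 \<le> (norm (M *v v + t *\<^sub>R (M *v u)))\<^sup>2"
      by (simp add: power_mult_distrib matrix_vector_right_distrib matrix_vector_mult_scaleR)
    then show ?thesis
      unfolding norm_add_scaleR_power2 uu [symmetric] K_def
      using v_eq by (simp add: algebra_simps)
  qed
  have "u \<bullet> u = 0"
  proof (rule ccontr)
    assume "u \<bullet> u \<noteq> 0"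
    then have pos: "0 < u \<bullet> u" by simp
    \<comment> \<open>A negative step so short that the quadratic term, at most u \<bullet> u in
      size after division by t, cannot outweigh the linear term 2 (u \<bullet> u). The summand 1
      keeps the denominator positive when K = 0.\<close>
    define t where "t = - (u \<bullet> u) / (\<bar>K\<bar> + 1)"
    have "t < 0" using pos by (simp add: t_def divide_neg_pos)
    moreover have "0 \<le> t * (2 * (u \<bullet> u) + t * K)"
      using K [of t] by (simp add: algebra_simps power2_eq_square)
    ultimately have "2 * (u \<bullet> u) + t * K \<le> 0"
      by (simp add: zero_le_mult_iff)
    moreover have "\<bar>t * K\<bar> \<le> u \<bullet> u"
    proof -
      have "\<bar>t * K\<bar> = (u \<bullet> u) * (\<bar>K\<bar> / (\<bar>K\<bar> + 1))"
        by (simp add: t_def abs_mult)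
      also have "\<dots> \<le> (u \<bullet> u) * 1"
        using pos by (intro mult_left_mono) auto
      finally show ?thesis by simp
    qed
    ultimately show False using pos by linarith
  qed
  then show ?thesis by (simp add: u_def)
qed

text \<open>The variational characterisation: a vector attaining the lower bound is an eigenvector,
  so c is a singular value, and the bound at any other eigenvector shows that no singular value is
  smaller.\<close>

lemma min_singular_value_eqI:
  fixes M :: "real^'k^'m"
  assumes c: "0 \<le> c" and low: "\<And>w. c * norm w \<le> norm (M *v w)"
    and v: "norm (M *v v) \<le> c * norm v" "v \<noteq> 0"
  shows "min_singular_value M = c"
  unfolding min_singular_value_def
proof (rule Min_eqI)
  show "finite (singular_values M)" by (rule finite_singular_values)
  show "c \<in> singular_values M"
    using c v minimizer_imp_eigenvector [OF c low v(1)] by (auto simp: singular_values_def)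
  fix s assume "s \<in> singular_values M"
  then obtain w where w: "0 \<le> s" "w \<noteq> 0" "(transpose M ** M) *v w = s\<^sup>2 *\<^sub>R w"
    by (auto simp: singular_values_def)
  have "(norm (M *v w))\<^sup>2 = ((transpose M ** M) *v w) \<bullet> w"
    by (simp only: power2_norm_eq_inner gram_mult inner_transpose_mult)
  then have "(norm (M *v w))\<^sup>2 = (s * norm w)\<^sup>2"
    by (simp add: w(3) power_mult_distrib power2_norm_eq_inner)
  then have "norm (M *v w) = s * norm w"
    using w(1) by (simp add: power2_eq_iff_nonneg)
  then show "c \<le> s" using low [of w] w(2) by simp
qed

text \<open>The norm of M v attains its infimum on the compact unit sphere; homogeneity extends the
  bound to all vectors.\<close>

lemma min_singular_value_attained:
  fixes M :: "real^'k^'m"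
  obtains v where "norm v = 1" "norm (M *v v) = min_singular_value M"
    "\<And>w. min_singular_value M * norm w \<le> norm (M *v w)"
proof -
  have "axis undefined 1 \<in> sphere (0::real^'k) 1" by simp
  then have "sphere (0::real^'k) 1 \<noteq> {}" by blast
  moreover have "continuous_on (sphere 0 1) (\<lambda>v. norm (M *v v))"
    by (intro continuous_intros linear_continuous_on) simp
  ultimately obtain v where v: "v \<in> sphere 0 1"
      "\<And>w. w \<in> sphere 0 1 \<Longrightarrow> norm (M *v v) \<le> norm (M *v w)"
    using continuous_attains_inf [of "sphere (0::real^'k) 1" "\<lambda>v. norm (M *v v)"] by auto
  have low: "norm (M *v v) * norm w \<le> norm (M *v w)" for w
  proof (cases "w = 0")
    case False
    have "norm (M *v v) \<le> norm (M *v (w /\<^sub>R norm w))"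
      using False by (intro v(2)) simp
    then show ?thesis
      using False by (simp add: matrix_vector_mult_scaleR field_simps)
  qed simp
  have eq: "min_singular_value M = norm (M *v v)"
    by (rule min_singular_value_eqI [of _ _ v]) (use v(1) low in auto)
  show ?thesis
    using that [of v] v(1) low by (simp add: eq)
qed

lemma min_singular_value_nonneg: "0 \<le> min_singular_value (M :: real^'k^'m)"
  by (metis min_singular_value_attained norm_ge_zero)

lemma min_singular_value_le: "min_singular_value (M :: real^'k^'m) * norm w \<le> norm (M *v w)"
  by (metis min_singular_value_attained)

text \<open>A minimising unit vector for M is a test vector for N. By symmetry the least singular
  value is Lipschitz with constant 1.\<close>

lemma min_singular_value_diff_le:
  fixes M N :: "real^'k^'m"
  shows "min_singular_value N \<le> min_singular_value M + norm (N - M)"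
proof -
  obtain v where v: "norm v = 1" "norm (M *v v) = min_singular_value M"
    by (rule min_singular_value_attained)
  have "min_singular_value N \<le> norm (N *v v)"
    using min_singular_value_le [of N v] v by simp
  also have "N *v v = M *v v + (N - M) *v v"
    by (simp add: matrix_vector_mult_diff_rdistrib)
  also have "norm \<dots> \<le> min_singular_value M + norm (N - M)"
    using norm_triangle_ineq [of "M *v v" "(N - M) *v v"] norm_matrix_vector_le [of "N - M" v] v by simp
  finally show ?thesis .
qed

lemma isCont_min_singular_value: "isCont min_singular_value (M :: real^'k^'m)"
  unfolding isCont_def
proof (rule LIM_I)
  fix r :: real assume "0 < r"
  moreover have "\<bar>min_singular_value N - min_singular_value M\<bar> \<le> norm (N - M)" for N
    using min_singular_value_diff_le [of N M] min_singular_value_diff_le [of M N]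
    by (simp add: norm_minus_commute abs_le_iff)
  ultimately show "\<exists>s>0. \<forall>x. x \<noteq> M \<and> norm (x - M) < s \<longrightarrow>
      norm (min_singular_value x - min_singular_value M) < r"
    by (intro exI [of _ r]) (auto intro: le_less_trans)
qed

lemma min_singular_value_eigenvector:
  fixes M :: "real^'k^'m"
  obtains v where "v \<noteq> 0" "(transpose M ** M) *v v = (min_singular_value M)\<^sup>2 *\<^sub>R v"
proof -
  obtain v where v: "norm v = 1" "norm (M *v v) = min_singular_value M"
    by (rule min_singular_value_attained)
  show ?thesis
    by (rule that [of v], use v in force, rule minimizer_imp_eigenvector)
      (use v min_singular_value_nonneg min_singular_value_le in auto)
qed

subsection \<open>The eigenvalue equation of the TLS solution\<close>

definition extend :: "real^'n \<Rightarrow> real \<Rightarrow> real^('n option)" where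
  "extend y \<eta> = (\<chi> i. case i of None \<Rightarrow> \<eta> | Some k \<Rightarrow> y $ k)"

lemma extend_nth [simp]: "extend y \<eta> $ None = \<eta>" "extend y \<eta> $ Some k = y $ k"
  by (simp_all add: extend_def)

lemma extend_cases:
  obtains y \<eta> where "v = extend y \<eta>"
proof
  show "v = extend (\<chi> k. v $ Some k) (v $ None)"
    by (simp add: vec_eq_iff extend_def split: option.split)
qed

lemma extend_eq_iff [simp]: "extend y \<eta> = extend y' \<eta>' \<longleftrightarrow> y = y' \<and> \<eta> = \<eta>'"
  by (metis extend_nth vec_eq_iff)

lemma extend_eq_0_iff [simp]: "extend y \<eta> = 0 \<longleftrightarrow> y = 0 \<and> \<eta> = 0"
  by (metis (no_types, lifting) extend_cases extend_nth vec_eq_iff zero_index)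

lemma scaleR_extend: "c *\<^sub>R extend y \<eta> = extend (c *\<^sub>R y) (c * \<eta>)"
  by (simp add: vec_eq_iff extend_def split: option.split)

lemma sum_UNIV_option:
  fixes f :: "'n::finite option \<Rightarrow> 'b::comm_monoid_add"
  shows "(\<Sum>k\<in>UNIV. f k) = f None + (\<Sum>k\<in>UNIV. f (Some k))"
  by (simp add: UNIV_option_conv sum.reindex)

lemma inner_extend: "extend y \<eta> \<bullet> extend y' \<eta>' = y \<bullet> y' + \<eta> * \<eta>'"
  by (simp add: inner_vec_def sum_UNIV_option)

lemma norm_extend_power2: "(norm (extend y \<eta>))\<^sup>2 = (norm y)\<^sup>2 + \<eta>\<^sup>2"
  by (simp add: power2_norm_eq_inner inner_extend) (simp add: power2_eq_square)

lemma augment_mult_extend: "augment A b *v extend y \<eta> = A *v y + \<eta> *\<^sub>R b"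
  by (simp add: vec_eq_iff matrix_vector_mult_def augment_def sum_UNIV_option)

lemma transpose_augment_mult:
  "transpose (augment A b) *v w = extend (transpose A *v w) (b \<bullet> w)"
proof -
  have "(transpose (augment A b) *v w) $ k = extend (transpose A *v w) (b \<bullet> w) $ k" for k
    by (cases k) (simp_all add: augment_def transpose_def matrix_vector_mult_def inner_vec_def
        del: transpose_matrix_vector)
  then show ?thesis by (simp add: vec_eq_iff)
qed

lemma augment_gram_mult_extend:
  "(transpose (augment A b) ** augment A b) *v extend y \<eta> =
     extend (transpose A *v (A *v y + \<eta> *\<^sub>R b)) (b \<bullet> (A *v y + \<eta> *\<^sub>R b))"
  by (simp only: gram_mult augment_mult_extend transpose_augment_mult)

definition shifted_gram :: "real^'n^'m \<Rightarrow> real^'m \<Rightarrow> real^'n^'n" where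
  "shifted_gram A b = transpose A ** A - (min_singular_value (augment A b))\<^sup>2 *\<^sub>R mat 1"

lemma shifted_gram_mult:
  "shifted_gram A b *v y =
     transpose A *v (A *v y) - (min_singular_value (augment A b))\<^sup>2 *\<^sub>R y"
  by (simp add: shifted_gram_def matrix_vector_mult_diff_rdistrib gram_mult
      scaleR_matrix_vector_assoc [symmetric] del: transpose_matrix_vector)

lemma tls_formula_eq_iff:
  assumes "invertible (shifted_gram A b)"
  shows "tls_formula A b = x \<longleftrightarrow> shifted_gram A b *v x = transpose A *v b"
  unfolding tls_formula_def shifted_gram_def [symmetric]
  by (rule matrix_inv_mult_eq [OF assms])

text \<open>A kernel vector y of P would satisfy |A y| = sigma_(n+1) |y|, below the least singular
  value of A unless y = 0.\<close>

lemma shifted_gram_invertible: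
  assumes "min_singular_value (augment A b) < min_singular_value A"
  shows "invertible (shifted_gram A b)"
  unfolding invertible_iff_ker
proof (intro allI impI)
  fix y assume "shifted_gram A b *v y = 0"
  then have "transpose A *v (A *v y) = (min_singular_value (augment A b))\<^sup>2 *\<^sub>R y"
    by (simp add: shifted_gram_mult del: transpose_matrix_vector)
  then have "(norm (A *v y))\<^sup>2 = (min_singular_value (augment A b) * norm y)\<^sup>2"
    by (metis inner_scaleR_left inner_transpose_mult power2_norm_eq_inner power_mult_distrib)
  then have eq: "norm (A *v y) = min_singular_value (augment A b) * norm y"
    by (simp add: power2_eq_iff_nonneg min_singular_value_nonneg)
  show "y = 0"
  proof (rule ccontr)
    assume "y \<noteq> 0"
    then have "min_singular_value (augment A b) * norm y < min_singular_value A * norm y"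
      using assms by simp
    then show False
      using min_singular_value_le [of A y] eq by simp
  qed
qed

text \<open>Simplicity of the least eigenvalue. The first n rows of the eigenvalue equation at (y,
  \<eta>) read P y = -\<eta> A^T b; \<eta> = 0 would force y = 0, and scaling \<eta> to -1 leaves
  the equation that defines the TLS formula.\<close>

lemma eigenvector_augment:
  assumes inv: "invertible (shifted_gram A b)"
    and v: "v \<noteq> 0"
      "(transpose (augment A b) ** augment A b) *v v = (min_singular_value (augment A b))\<^sup>2 *\<^sub>R v"
  shows "\<exists>\<alpha>. \<alpha> \<noteq> 0 \<and> v = \<alpha> *\<^sub>R extend (tls_formula A b) (-1)"
proof -
  obtain y \<eta> where y: "v = extend y \<eta>" by (rule extend_cases)
  have eq: "shifted_gram A b *v y = transpose A *v ((- \<eta>) *\<^sub>R b)"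
    unfolding matrix_vector_mult_scaleR using v(2)
    by (simp add: y augment_gram_mult_extend scaleR_extend shifted_gram_mult
        matrix_vector_right_distrib matrix_vector_mult_scaleR algebra_simps
        del: transpose_matrix_vector)
  have "\<eta> \<noteq> 0"
  proof
    assume "\<eta> = 0"
    then have "y = 0" using eq inv unfolding invertible_iff_ker by simp
    then show False using v(1) y \<open>\<eta> = 0\<close> by simp
  qed
  have "shifted_gram A b *v ((- 1 / \<eta>) *\<^sub>R y) = transpose A *v b"
    unfolding matrix_vector_mult_scaleR eq using \<open>\<eta> \<noteq> 0\<close>
    by (simp add: matrix_vector_mult_scaleR del: transpose_matrix_vector)
  then have "tls_formula A b = (- 1 / \<eta>) *\<^sub>R y"
    by (simp add: tls_formula_eq_iff [OF inv])
  then have "v = (- \<eta>) *\<^sub>R extend (tls_formula A b) (-1)"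
    using \<open>\<eta> \<noteq> 0\<close> by (simp add: y scaleR_extend)
  then show ?thesis using \<open>\<eta> \<noteq> 0\<close> by (metis neg_equal_0_iff_equal)
qed

lemma tls_formula_eigenvector:
  assumes inv: "invertible (shifted_gram A b)"
  shows "(transpose (augment A b) ** augment A b) *v extend (tls_formula A b) (-1) =
    (min_singular_value (augment A b))\<^sup>2 *\<^sub>R extend (tls_formula A b) (-1)"
proof -
  obtain v where v: "v \<noteq> 0"
      "(transpose (augment A b) ** augment A b) *v v = (min_singular_value (augment A b))\<^sup>2 *\<^sub>R v"
    by (rule min_singular_value_eigenvector)
  then obtain \<alpha> where "\<alpha> \<noteq> 0" "v = \<alpha> *\<^sub>R extend (tls_formula A b) (-1)"
    using eigenvector_augment [OF inv] by blast
  with v(2) show ?thesis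
    by (metis (no_types, lifting) matrix_vector_mult_scaleR scaleR_left_commute
        scaleR_cancel_left)
qed

section \<open>Rank-one corrections and the minimisers of the TLS problem\<close>

definition outer :: "real^'m \<Rightarrow> real^'n \<Rightarrow> real^'n^'m" where
  "outer a c = (\<chi> i j. a $ i * c $ j)"

lemma outer_mult: "outer a c *v y = (c \<bullet> y) *\<^sub>R a"
  by (simp add: vec_eq_iff outer_def matrix_vector_mult_def inner_vec_def sum_distrib_left ac_simps)

lemma inner_outer: "M \<bullet> outer a c = a \<bullet> (M *v c)"
  by (simp add: outer_def inner_vec_def matrix_vector_mult_def sum_distrib_left ac_simps)

lemma norm_outer: "norm (outer a c) = norm a * norm c"
  by (rule power2_eq_imp_eq)
    (simp_all add: power2_norm_eq_inner inner_outer outer_mult power_mult_distrib)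

lemma augment_outer: "augment (outer a c) (\<eta> *\<^sub>R a) = outer a (extend c \<eta>)"
  by (simp add: vec_eq_iff augment_def outer_def extend_def split: option.split)

text \<open>A perturbation \<open>[E r]\<close> making \<open>x\<close> exact maps \<open>(x, 1)\<close> to \<open>b - A x\<close>, so its squared
  Frobenius norm is at least the Rayleigh quotient of \<open>[A b]\<close> at \<open>(x, -1)\<close>, with equality for a rank-one choice.\<close>

lemma tls_solution_eq_formula:
  assumes inv: "invertible (shifted_gram A b)" and sol: "tls_solution A b x"
  shows "x = tls_formula A b"
proof -
  define \<mu> where "\<mu> = min_singular_value (augment A b)"
  define y where "y = tls_formula A b"
  define z where "z = extend y (-1)"
  have \<mu>: "0 \<le> \<mu>" by (simp add: \<mu>_def min_singular_value_nonneg)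
  have "(norm (augment A b *v z))\<^sup>2 = ((transpose (augment A b) ** augment A b) *v z) \<bullet> z"
    by (simp only: power2_norm_eq_inner gram_mult inner_transpose_mult)
  then have "(norm (augment A b *v z))\<^sup>2 = (\<mu> * norm z)\<^sup>2"
    unfolding z_def y_def tls_formula_eigenvector [OF inv]
    by (simp add: power_mult_distrib power2_norm_eq_inner \<mu>_def)
  then have normz: "norm (augment A b *v z) = \<mu> * norm z"
    using \<mu> by (simp add: power2_eq_iff_nonneg)
  \<comment> \<open>The correction [E r] acts on (w, 1) but [A b] on (w, -1); the change of sign
    does not affect the norm.\<close>
  have z_pos: "norm (extend w 1) > 0" "norm (extend w 1) = norm (extend w (-1))"
    for w :: "real^'n"
    by (simp_all add: norm_extend_power2 power2_eq_imp_eq)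
  obtain E r where feas: "tls_feasible A b E r"
    and opt: "\<And>E' r'. tls_feasible A b E' r' \<Longrightarrow> norm (augment E r) \<le> norm (augment E' r')"
    and x: "(A + E) *v x = b - r"
    using sol unfolding tls_solution_def by blast
  \<comment> \<open>Solves (|y|^2 + 1) c = b - A y, so that the correction c (y, 1)^T makes y exact.
    The factor \<open>1 *\<^sub>R c\<close> below lets \<open>augment_outer\<close> recognise this
    rank-one form.\<close>
  define c where "c = (1 / (norm (extend y 1))\<^sup>2) *\<^sub>R (b - A *v y)"
  have "(norm y)\<^sup>2 + 1 \<noteq> 0" by (metis add_nonneg_pos less_numeral_extra(1,3) zero_le_power2)
  then have "(A + outer c y) *v y = b - 1 *\<^sub>R c"
    by (simp add: matrix_vector_mult_add_rdistrib outer_mult c_def norm_extend_power2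
        power2_norm_eq_inner [symmetric] vec_eq_iff field_simps)
  then have "tls_feasible A b (outer c y) (1 *\<^sub>R c)"
    unfolding tls_feasible_def by (metis rangeI)
  then have "norm (augment E r) \<le> norm (augment (outer c y) (1 *\<^sub>R c))"
    by (rule opt)
  also have "\<dots> = norm c * norm (extend y 1)"
    by (simp only: augment_outer norm_outer)
  also have "\<dots> = norm (augment A b *v z) / norm (extend y 1)"
    using z_pos(1) [of y]
    by (simp add: c_def z_def augment_mult_extend norm_minus_commute power2_eq_square)
  also have "\<dots> = \<mu>"
    unfolding normz using z_pos [of y] by (simp add: z_def)
  finally have le: "norm (augment E r) \<le> \<mu>" .
  have "augment E r *v extend x 1 = - (augment A b *v extend x (-1))"
    using x by (simp add: augment_mult_extend matrix_vector_mult_add_rdistrib algebra_simps)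
  then have "norm (augment A b *v extend x (-1)) = norm (augment E r *v extend x 1)"
    by simp
  also have "\<dots> \<le> norm (augment E r) * norm (extend x 1)"
    by (rule norm_matrix_vector_le)
  also have "\<dots> \<le> \<mu> * norm (extend x (-1))"
    using le by (simp add: z_pos(2) mult_right_mono)
  finally have "(transpose (augment A b) ** augment A b) *v extend x (-1) = \<mu>\<^sup>2 *\<^sub>R extend x (-1)"
    using minimizer_imp_eigenvector [OF \<mu>] min_singular_value_le \<mu>_def by metis
  then obtain \<alpha> where "extend x (-1) = \<alpha> *\<^sub>R extend (tls_formula A b) (-1)"
    using eigenvector_augment [OF inv, of "extend x (-1)"] by (auto simp: \<mu>_def)
  \<comment> \<open>Both last coordinates are -1, hence \<open>\<alpha>\<close> = 1.\<close>
  then show ?thesis by (simp add: scaleR_extend)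
qed

subsection \<open>Derivatives of products and continuity of matrix inversion\<close>

text \<open>The product rule term that would differentiate \<open>k\<close> is multiplied by f a =
  0, so continuity of \<open>k\<close> suffices. The remainder splits into k(y) times the remainder
  of \<open>f\<close>, and k(y) - k(a) times f'(y - a); both are o(|y - a|).\<close>

lemma has_derivative_vanishing_factor:
  fixes prod :: "'b::real_normed_vector \<Rightarrow> 'c::real_normed_vector \<Rightarrow> 'd::real_normed_vector"
  assumes prod: "bounded_bilinear prod" and k: "isCont k a"
    and f: "(f has_derivative f') (at a)" and fa: "f a = 0"
  shows "((\<lambda>x. prod (k x) (f x)) has_derivative (\<lambda>h. prod (k a) (f' h))) (at a)"
proof -
  interpret prod: bounded_bilinear prod by fact
  obtain K where K: "\<And>u v. norm (prod u v) \<le> norm u * norm v * K" "0 < K"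
    using prod.pos_bounded by blast
  interpret f': bounded_linear f' using f by (rule has_derivative_bounded_linear)
  obtain L where L: "\<And>h. norm (f' h) \<le> norm h * L" "0 < L"
    using f'.pos_bounded by blast
  define R where "R y = norm (f y - f a - f' (y - a)) / norm (y - a)" for y
  have R: "(R \<longlongrightarrow> 0) (at a)"
    using f unfolding has_derivative_iff_norm R_def by blast
  have "((\<lambda>y. K * norm (k y) * R y + K * norm (k y - k a) * L) \<longlongrightarrow>
      K * norm (k a) * 0 + K * norm (k a - k a) * L) (at a)"
    using k unfolding isCont_def by (intro tendsto_intros R)
  then have lim: "((\<lambda>y. K * norm (k y) * R y + K * norm (k y - k a) * L) \<longlongrightarrow> 0) (at a)"
    by simp
  have "((\<lambda>y. norm (prod (k y) (f y) - prod (k a) (f a) - prod (k a) (f' (y - a))) / norm (y - a))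
      \<longlongrightarrow> 0) (at a)"
  proof (rule tendsto_sandwich [OF _ _ tendsto_const lim])
    show "\<forall>\<^sub>F y in at a. norm (prod (k y) (f y) - prod (k a) (f a) - prod (k a) (f' (y - a))) / norm (y - a)
        \<le> K * norm (k y) * R y + K * norm (k y - k a) * L"
    proof (rule eventually_mono [OF eventually_neq_at_within [of a a]])
      fix y assume "y \<noteq> a"
      then have pos: "0 < norm (y - a)" by simp
      have "prod (k y) (f y) - prod (k a) (f a) - prod (k a) (f' (y - a)) =
          prod (k y) (f y - f a - f' (y - a)) + prod (k y - k a) (f' (y - a))"
        by (simp add: fa prod.diff_left prod.diff_right prod.zero_right)
      then have "norm (prod (k y) (f y) - prod (k a) (f a) - prod (k a) (f' (y - a))) \<le>
          norm (k y) * norm (f y - f a - f' (y - a)) * K + norm (k y - k a) * norm (f' (y - a)) * K"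
        by (metis (no_types, lifting) K(1) add_mono norm_triangle_le)
      also have "\<dots> \<le> norm (k y) * norm (f y - f a - f' (y - a)) * K +
          norm (k y - k a) * (norm (y - a) * L) * K"
        using K(2) by (intro add_left_mono mult_right_mono mult_left_mono L) auto
      also have "\<dots> = (K * norm (k y) * R y + K * norm (k y - k a) * L) * norm (y - a)"
        using pos by (simp add: R_def algebra_simps)
      finally show "norm (prod (k y) (f y) - prod (k a) (f a) - prod (k a) (f' (y - a))) / norm (y - a)
        \<le> K * norm (k y) * R y + K * norm (k y - k a) * L"
        using pos by (simp add: pos_divide_le_eq)
    qed
  qed auto
  moreover have "bounded_linear (\<lambda>h. prod (k a) (f' h))"
    using prod.bounded_linear_right f'.bounded_linear_axioms by (rule bounded_linear_compose)
  ultimately show ?thesis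
    unfolding has_derivative_iff_norm by blast
qed

lemma has_derivative_transform_nhds:
  assumes "(f has_derivative f') (at x)" "\<forall>\<^sub>F y in nhds x. f y = g y"
  shows "(g has_derivative f') (at x)"
  using has_derivative_transform_eventually [OF assms(1), of g]
    eventually_nhds_x_imp_x [OF assms(2)] filter_leD [OF at_within_le_nhds assms(2)]
  by simp

lemma bounded_bilinear_matrix_vector_mult:
  "bounded_bilinear ((*v) :: real^'n^'m \<Rightarrow> real^'n \<Rightarrow> real^'m)"
  unfolding bilinear_conv_bounded_bilinear [symmetric] bilinear_def
  by (auto intro!: linearI simp: algebra_simps scaleR_matrix_vector_assoc)

lemma bounded_linear_transpose: "bounded_linear (transpose :: real^'n^'m \<Rightarrow> real^'m^'n)"
  unfolding linear_conv_bounded_linear [symmetric]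
  by (intro linearI) (simp_all add: transpose_def vec_eq_iff)

lemma bounded_bilinear_matrix_matrix_mult:
  "bounded_bilinear ((**) :: real^'n^'m \<Rightarrow> real^'k^'n \<Rightarrow> real^'k^'m)"
  unfolding bilinear_conv_bounded_bilinear [symmetric] bilinear_def
  by (auto intro!: linearI simp: matrix_matrix_mult_def vec_eq_iff sum.distrib algebra_simps
      sum_distrib_left)

lemma bounded_linear_mat_part: "bounded_linear mat_part"
  unfolding linear_conv_bounded_linear [symmetric]
  by (intro linearI) (simp_all add: mat_part_def vec_eq_iff)

lemma bounded_linear_rhs_part: "bounded_linear rhs_part"
  unfolding linear_conv_bounded_linear [symmetric]
  by (intro linearI) (simp_all add: rhs_part_def vec_eq_iff)

lemma isCont_det: "isCont (det :: real^'n^'n \<Rightarrow> real) A"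
  unfolding det_def [abs_def] by (intro continuous_intros)

lemma isCont_eventually_nonzero:
  fixes f :: "'a::t2_space \<Rightarrow> 'b::t1_space"
  assumes "isCont f a" "f a \<noteq> c"
  shows "\<forall>\<^sub>F z in nhds a. f z \<noteq> c"
proof (rule tendsto_imp_eventually_ne)
  show "(f \<longlongrightarrow> f a) (nhds a)"
    using assms(1) by (simp add: isCont_def tendsto_nhds_iff)
qed fact

text \<open>By Cramer's rule each component is a quotient of determinants, continuous near a point
  where the denominator is nonzero. \<open>N z k\<close> is F z with column k replaced by c.\<close>

lemma isCont_matrix_inv_mult:
  fixes F :: "'a::t2_space \<Rightarrow> real^'n^'n"
  assumes F: "isCont F a" and inv: "invertible (F a)"
  shows "isCont (\<lambda>z. matrix_inv (F z) *v c) a"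
proof -
  define N where "N z k = (\<chi> i j. if j = k then c $ i else F z $ i $ j)" for z k
  have det: "isCont (\<lambda>z. det (G z)) a" if "isCont G a" for G :: "'a \<Rightarrow> real^'n^'n"
    by (rule isCont_o2 [OF that isCont_det])
  have nz: "det (F a) \<noteq> 0" using inv by (simp add: invertible_det_nz)
  have ev: "\<forall>\<^sub>F z in nhds a. det (F z) \<noteq> 0"
    by (rule isCont_eventually_nonzero [OF det [OF F] nz])
  have N: "isCont (\<lambda>z. N z k) a" for k
    unfolding isCont_def
  proof (intro vec_tendstoI)
    fix i j
    have "((\<lambda>z. F z $ i $ j) \<longlongrightarrow> F a $ i $ j) (at a)"
      using F unfolding isCont_def by (intro tendsto_vec_nth)
    then show "((\<lambda>z. N z k $ i $ j) \<longlongrightarrow> N a k $ i $ j) (at a)"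
      by (simp add: N_def)
  qed
  have "isCont (\<lambda>z. det (N z k) / det (F z)) a" for k
    using det [OF F] det [OF N] nz by (intro continuous_intros)
  then have "isCont (\<lambda>z. \<chi> k. det (N z k) / det (F z)) a"
    unfolding isCont_def by (intro vec_tendstoI) simp
  moreover have "\<forall>\<^sub>F z in nhds a. (\<chi> k. det (N z k) / det (F z)) = matrix_inv (F z) *v c"
    using ev
  proof (rule eventually_mono)
    fix z assume nz: "det (F z) \<noteq> 0"
    then have "F z *v (\<chi> k. det (N z k) / det (F z)) = c"
      unfolding N_def using cramer [OF nz] by blast
    then show "(\<chi> k. det (N z k) / det (F z)) = matrix_inv (F z) *v c"
      using nz matrix_inv_mult_eq [of "F z"] by (metis invertible_det_nz)
  qed
  ultimately show ?thesis
    by (rule iffD1 [OF isCont_cong, rotated])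
qed

lemma isCont_matrix_inv:
  fixes F :: "'a::t2_space \<Rightarrow> real^'n^'n"
  assumes "isCont F a" and "invertible (F a)"
  shows "isCont (\<lambda>z. matrix_inv (F z)) a"
proof -
  have "isCont (\<lambda>z. matrix_inv (F z) $ i $ j) a" for i j
  proof -
    have "isCont (\<lambda>z. (matrix_inv (F z) *v axis j 1) $ i) a"
      by (intro continuous_intros isCont_matrix_inv_mult assms)
    then show ?thesis
      by (simp add: matrix_vector_mult_basis column_def)
  qed
  then show ?thesis
    unfolding isCont_def by (intro vec_tendstoI)
qed

lemma isCont_bounded_bilinear:
  assumes "bounded_bilinear h" "isCont f a" "isCont g a"
  shows "isCont (\<lambda>z. h (f z) (g z)) a"
  using bounded_bilinear.continuous [OF assms(1)] assms(2,3) by blast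

subsection \<open>Differentiability of the TLS map\<close>

definition data_matrix :: "real^('n::finite \<times> 'm::finite + 'm) \<Rightarrow> real^('n option)^'m" where
  "data_matrix z = augment (mat_part z) (rhs_part z)"

text \<open>This is lambda as a function of the stacked data vector. The square is the quantity that
  enters P and the eigenvalue equation.\<close>

definition min_eigenvalue :: "real^('n::finite \<times> 'm::finite + 'm) \<Rightarrow> real" where
  "min_eigenvalue z = (min_singular_value (data_matrix z))\<^sup>2"

definition data_gram :: "real^('n::finite \<times> 'm::finite + 'm) \<Rightarrow> real^'n^'n" where
  "data_gram z = shifted_gram (mat_part z) (rhs_part z)"

lemma bounded_linear_data_matrix: "bounded_linear data_matrix"
  unfolding linear_conv_bounded_linear [symmetric]
  by (intro linearI)
    (simp_all add: data_matrix_def augment_def mat_part_def rhs_part_def vec_eq_iff split: option.split)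

lemma isCont_min_eigenvalue: "isCont min_eigenvalue z"
  unfolding min_eigenvalue_def [abs_def]
  by (intro continuous_intros isCont_o2 [OF _ isCont_min_singular_value]
      linear_continuous_at bounded_linear_data_matrix)

lemma isCont_data_gram: "isCont data_gram z"
  unfolding data_gram_def [abs_def] shifted_gram_def data_matrix_def [symmetric]
    min_eigenvalue_def [symmetric]
  by (intro continuous_intros isCont_bounded_bilinear [OF bounded_bilinear_matrix_matrix_mult]
      isCont_min_eigenvalue bounded_linear.isCont [OF bounded_linear_transpose]
      linear_continuous_at bounded_linear_mat_part)

lemma data_gram_mult:
  "data_gram z *v y = transpose (mat_part z) *v (mat_part z *v y) - min_eigenvalue z *\<^sub>R y"
  by (simp add: data_gram_def shifted_gram_mult min_eigenvalue_def data_matrix_def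
      del: transpose_matrix_vector)

lemma eventually_invertible_data_gram:
  assumes "invertible (data_gram a)"
  shows "\<forall>\<^sub>F z in nhds a. invertible (data_gram z)"
proof -
  have "isCont (\<lambda>z. det (data_gram z)) a"
    by (rule isCont_o2 [OF isCont_data_gram isCont_det])
  then have "\<forall>\<^sub>F z in nhds a. det (data_gram z) \<noteq> 0"
    using assms by (intro isCont_eventually_nonzero) (auto simp: invertible_det_nz)
  then show ?thesis by (simp add: invertible_det_nz)
qed

lemma isCont_tls_map:
  assumes inv: "invertible (data_gram a)"
  shows "isCont tls_map a"
proof -
  have "isCont (\<lambda>z. matrix_inv (data_gram z) *v (transpose (mat_part z) *v rhs_part z)) a"
    by (intro isCont_bounded_bilinear [OF bounded_bilinear_matrix_vector_mult] isCont_matrix_inv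
        isCont_data_gram inv bounded_linear.isCont [OF bounded_linear_transpose]
        linear_continuous_at bounded_linear_mat_part bounded_linear_rhs_part)
  then show ?thesis
    by (simp add: tls_map_def [abs_def] tls_formula_def data_gram_def shifted_gram_def
        del: transpose_matrix_vector)
qed

lemma isCont_extend:
  assumes "isCont f a"
  shows "isCont (\<lambda>z. extend (f z) c) a"
proof -
  have "((\<lambda>z. extend (f z) c $ i) \<longlongrightarrow> extend (f a) c $ i) (at a)" for i
    using assms by (cases i) (auto simp: isCont_def intro!: tendsto_vec_nth)
  then show ?thesis
    unfolding isCont_def by (rule vec_tendstoI)
qed

lemma data_matrix_eigenvector:
  assumes "invertible (data_gram z)"
  shows "transpose (data_matrix z) *v (data_matrix z *v extend (tls_map z) (-1)) =
    min_eigenvalue z *\<^sub>R extend (tls_map z) (-1)"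
  using tls_formula_eigenvector [OF assms [unfolded data_gram_def]]
  by (simp only: data_matrix_def min_eigenvalue_def tls_map_def gram_mult)

lemma bounded_linear_data_matrix_mult:
  "bounded_linear (\<lambda>z. data_matrix z *v v)"
  using bounded_linear_compose [OF bounded_bilinear.bounded_linear_left
      [OF bounded_bilinear_matrix_vector_mult] bounded_linear_data_matrix] .

lemma bounded_linear_mat_part_mult:
  "bounded_linear (\<lambda>z. mat_part z *v v)"
  using bounded_linear_compose [OF bounded_bilinear.bounded_linear_left
      [OF bounded_bilinear_matrix_vector_mult] bounded_linear_mat_part] .

lemma data_matrix_mult_extend: "data_matrix z *v extend x (-1) = mat_part z *v x - rhs_part z"
  by (simp add: data_matrix_def augment_mult_extend)

text \<open>For eigenvectors \<open>\<zeta>, \<zeta>'\<close> of the Gram matrices \<open>C, C'\<close> with eigenvalues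
  \<open>\<lambda>, \<lambda>'\<close>, symmetry gives \<open>(\<lambda>' - \<lambda>) (\<zeta> \<bullet> \<zeta>') = \<zeta>' \<bullet> ((C' - C) \<zeta>)\<close>, so differentiability of the
  eigenvalue needs only continuity of the eigenvector.\<close>

lemma has_derivative_min_eigenvalue:
  fixes a :: "real^('n::finite \<times> 'm::finite + 'm)"
  assumes inv: "invertible (data_gram a)"
  defines "\<zeta> \<equiv> extend (tls_map a) (-1)"
  shows "(min_eigenvalue has_derivative
    (\<lambda>d. 2 * ((data_matrix a *v \<zeta>) \<bullet> (data_matrix d *v \<zeta>)) / (norm \<zeta>)\<^sup>2)) (at a)"
proof -
  define \<zeta>' where "\<zeta>' z = extend (tls_map z) (-1)" for z :: "real^('n \<times> 'm + 'm)"
  define F where "F z = transpose (data_matrix z) *v (data_matrix z *v \<zeta>)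
    - transpose (data_matrix a) *v (data_matrix a *v \<zeta>)" for z :: "real^('n \<times> 'm + 'm)"
  \<comment> \<open>Normalised so that k z \<bullet> F z, where F z is the change of the Gram matrix
    applied to the old eigenvector, is exactly the change of the eigenvalue.\<close>
  define k where "k z = (1 / (\<zeta> \<bullet> \<zeta>' z)) *\<^sub>R \<zeta>' z" for z :: "real^('n \<times> 'm + 'm)"
  have \<zeta>a: "\<zeta>' a = \<zeta>" by (simp add: \<zeta>'_def \<zeta>_def)
  have \<zeta>nz: "\<zeta> \<bullet> \<zeta>' a \<noteq> 0" by (simp add: \<zeta>a) (simp add: \<zeta>_def)
  have cont: "isCont \<zeta>' a"
    unfolding \<zeta>'_def [abs_def] by (intro isCont_extend isCont_tls_map inv)
  have contk: "isCont k a"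
    unfolding k_def [abs_def] by (intro continuous_intros cont \<zeta>nz)
  have dT: "((\<lambda>z. transpose (data_matrix z)) has_derivative (\<lambda>d. transpose (data_matrix d))) (at a)"
    by (intro bounded_linear_imp_has_derivative
        bounded_linear_compose [OF bounded_linear_transpose] bounded_linear_data_matrix)
  have dM: "((\<lambda>z. data_matrix z *v \<zeta>) has_derivative (\<lambda>d. data_matrix d *v \<zeta>)) (at a)"
    by (rule bounded_linear_imp_has_derivative [OF bounded_linear_data_matrix_mult])
  have dF: "(F has_derivative (\<lambda>d. transpose (data_matrix a) *v (data_matrix d *v \<zeta>)
      + transpose (data_matrix d) *v (data_matrix a *v \<zeta>))) (at a)"
    unfolding F_def [abs_def]
    using has_derivative_diff [OF bounded_bilinear.FDERIV
        [OF bounded_bilinear_matrix_vector_mult dT dM] has_derivative_const] by simp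
  have "F a = 0" by (simp add: F_def)
  from has_derivative_vanishing_factor [OF bounded_bilinear_inner contk dF this]
  have "((\<lambda>z. min_eigenvalue a + k z \<bullet> F z) has_derivative
      (\<lambda>d. 0 + k a \<bullet> (transpose (data_matrix a) *v (data_matrix d *v \<zeta>)
        + transpose (data_matrix d) *v (data_matrix a *v \<zeta>)))) (at a)"
    by (intro has_derivative_add has_derivative_const)
  moreover have "\<forall>\<^sub>F z in nhds a. min_eigenvalue a + k z \<bullet> F z = min_eigenvalue z"
  proof -
    have "\<forall>\<^sub>F z in nhds a. \<zeta> \<bullet> \<zeta>' z \<noteq> 0"
      using cont \<zeta>nz by (intro isCont_eventually_nonzero continuous_intros) auto
    with eventually_invertible_data_gram [OF inv] show ?thesis
    proof eventually_elim
      case (elim z)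
      have "\<zeta>' z \<bullet> (transpose (data_matrix z) *v (data_matrix z *v \<zeta>)) =
          (transpose (data_matrix z) *v (data_matrix z *v \<zeta>' z)) \<bullet> \<zeta>"
        by (metis inner_commute inner_transpose_mult)
      also have "\<dots> = min_eigenvalue z * (\<zeta> \<bullet> \<zeta>' z)"
        unfolding \<zeta>'_def data_matrix_eigenvector [OF elim(1)] by (simp add: inner_commute)
      finally have "\<zeta>' z \<bullet> F z = (min_eigenvalue z - min_eigenvalue a) * (\<zeta> \<bullet> \<zeta>' z)"
        using data_matrix_eigenvector [OF inv]
        by (simp add: F_def \<zeta>_def inner_diff_right inner_commute algebra_simps
            del: transpose_matrix_vector)
      then show ?case using elim(2) by (simp add: k_def)
    qed
  qed
  ultimately have "(min_eigenvalue has_derivative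
      (\<lambda>d. 0 + k a \<bullet> (transpose (data_matrix a) *v (data_matrix d *v \<zeta>)
        + transpose (data_matrix d) *v (data_matrix a *v \<zeta>)))) (at a)"
    by (rule has_derivative_transform_nhds)
  \<comment> \<open>At the base point k is \<open>\<zeta>\<close> / |\<open>\<zeta>\<close>|^2, and
    the two halves of the derivative of the Gram matrix contribute equally, whence the factor
    2.\<close>
  moreover have "0 + k a \<bullet> (transpose (data_matrix a) *v (data_matrix d *v \<zeta>)
        + transpose (data_matrix d) *v (data_matrix a *v \<zeta>)) =
      2 * ((data_matrix a *v \<zeta>) \<bullet> (data_matrix d *v \<zeta>)) / (norm \<zeta>)\<^sup>2" for d
  proof -
    have "\<zeta> \<bullet> (transpose M *v w) = w \<bullet> (M *v \<zeta>)" for M :: "real^('n option)^'m" and w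
      by (metis inner_commute inner_transpose_mult)
    then show ?thesis
      by (simp add: k_def \<zeta>a inner_add_right inner_commute power2_norm_eq_inner
          del: transpose_matrix_vector)
  qed
  ultimately show ?thesis by simp
qed

text \<open>With x frozen, x(z) - x = P(z)^(-1) h(z) holds exactly near \<open>a\<close>, where h(z)
  = A_z^T b_z - P(z) x is the residual of the old solution in the new system. As h vanishes at
  \<open>a\<close>, continuity of the inverse suffices.\<close>

lemma has_derivative_tls_map:
  fixes a :: "real^('n::finite \<times> 'm::finite + 'm)"
  assumes inv: "invertible (data_gram a)"
  defines "x \<equiv> tls_map a"
  defines "r \<equiv> mat_part a *v x - rhs_part a"
  shows "(tls_map has_derivative (\<lambda>d. matrix_inv (data_gram a) *v
    ((2 * (r \<bullet> (mat_part d *v x - rhs_part d)) / ((norm x)\<^sup>2 + 1)) *\<^sub>R x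
      - transpose (mat_part d) *v r
      - transpose (mat_part a) *v (mat_part d *v x - rhs_part d)))) (at a)"
proof -
  define h where "h z = min_eigenvalue z *\<^sub>R x
    - transpose (mat_part z) *v (mat_part z *v x - rhs_part z)" for z :: "real^('n \<times> 'm + 'm)"
  have dT: "((\<lambda>z. transpose (mat_part z)) has_derivative (\<lambda>d. transpose (mat_part d))) (at a)"
    by (intro bounded_linear_imp_has_derivative
        bounded_linear_compose [OF bounded_linear_transpose] bounded_linear_mat_part)
  have dr: "((\<lambda>z. mat_part z *v x - rhs_part z) has_derivative (\<lambda>d. mat_part d *v x - rhs_part d)) (at a)"
    by (intro bounded_linear_imp_has_derivative bounded_linear_sub bounded_linear_mat_part_mult
        bounded_linear_rhs_part)
  have norm_x: "(norm (extend x (-1)))\<^sup>2 = (norm x)\<^sup>2 + 1"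
    by (simp add: norm_extend_power2)
  have "(min_eigenvalue has_derivative
      (\<lambda>d. 2 * (r \<bullet> (mat_part d *v x - rhs_part d)) / ((norm x)\<^sup>2 + 1))) (at a)"
    using has_derivative_min_eigenvalue [OF inv]
    unfolding x_def [symmetric] data_matrix_mult_extend norm_x r_def [symmetric] .
  then have dl: "((\<lambda>z. min_eigenvalue z *\<^sub>R x) has_derivative
      (\<lambda>d. (2 * (r \<bullet> (mat_part d *v x - rhs_part d)) / ((norm x)\<^sup>2 + 1)) *\<^sub>R x)) (at a)"
    by (rule has_derivative_scaleR_left)
  have dh: "(h has_derivative (\<lambda>d. (2 * (r \<bullet> (mat_part d *v x - rhs_part d)) / ((norm x)\<^sup>2 + 1)) *\<^sub>R x
      - transpose (mat_part d) *v r
      - transpose (mat_part a) *v (mat_part d *v x - rhs_part d))) (at a)"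
    unfolding h_def [abs_def]
    by (rule has_derivative_eq_rhs, rule has_derivative_diff [OF dl bounded_bilinear.FDERIV
        [OF bounded_bilinear_matrix_vector_mult dT dr]])
      (simp add: r_def fun_eq_iff algebra_simps)
  have h: "h z = transpose (mat_part z) *v rhs_part z - data_gram z *v x" for z
    by (simp add: h_def data_gram_mult matrix_vector_mult_diff_distrib del: transpose_matrix_vector)
  have tls: "data_gram z *v tls_map z = transpose (mat_part z) *v rhs_part z"
    if "invertible (data_gram z)" for z
    using that tls_formula_eq_iff unfolding data_gram_def tls_map_def by blast
  have "h a = 0" using tls [OF inv] by (simp add: h x_def)
  have inv_h: "matrix_inv (data_gram z) *v h z = tls_map z - x" if "invertible (data_gram z)" for z
    unfolding matrix_inv_mult_eq [OF that]
    using tls [OF that] by (simp add: h matrix_vector_mult_diff_distrib del: transpose_matrix_vector)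
  have "isCont (\<lambda>z. matrix_inv (data_gram z)) a"
    by (rule isCont_matrix_inv [OF isCont_data_gram inv])
  from has_derivative_add [OF has_derivative_const [of x] has_derivative_vanishing_factor
      [OF bounded_bilinear_matrix_vector_mult this dh \<open>h a = 0\<close>]]
  have "((\<lambda>z. x + matrix_inv (data_gram z) *v h z) has_derivative (\<lambda>d. matrix_inv (data_gram a) *v
    ((2 * (r \<bullet> (mat_part d *v x - rhs_part d)) / ((norm x)\<^sup>2 + 1)) *\<^sub>R x
      - transpose (mat_part d) *v r
      - transpose (mat_part a) *v (mat_part d *v x - rhs_part d)))) (at a)"
    by simp
  moreover have "\<forall>\<^sub>F z in nhds a. x + matrix_inv (data_gram z) *v h z = tls_map z"
    using eventually_invertible_data_gram [OF inv] by eventually_elim (simp add: inv_h)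
  ultimately show ?thesis
    by (rule has_derivative_transform_nhds)
qed

subsection \<open>The norm of the derivative\<close>

text \<open>Stacking is an isometry for the Frobenius and Euclidean inner products, which lets the
  adjoint of the derivative be read off as a matrix and a vector.\<close>

lemma inner_vec_data: "d \<bullet> vec_data G g = mat_part d \<bullet> G + rhs_part d \<bullet> g"
proof -
  have "(\<Sum>k\<in>UNIV. d $ k * vec_data G g $ k) =
      (\<Sum>p\<in>UNIV \<times> UNIV. d $ Inl p * vec_data G g $ Inl p) + (\<Sum>i\<in>UNIV. d $ Inr i * vec_data G g $ Inr i)"
    unfolding UNIV_sum UNIV_Times_UNIV
    by (subst sum.union_disjoint) (auto simp: sum.reindex)
  also have "(\<Sum>p\<in>UNIV \<times> UNIV. d $ Inl p * vec_data G g $ Inl p) =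
      (\<Sum>i\<in>UNIV. \<Sum>j\<in>UNIV. d $ Inl (j, i) * G $ i $ j)"
    by (subst sum.swap) (simp add: sum.cartesian_product vec_data_def case_prod_beta)
  finally show ?thesis
    by (simp add: inner_vec_def mat_part_def rhs_part_def vec_data_def)
qed

text \<open>Bound |M^T y|^2 = y \<bullet> M M^T y by Cauchy-Schwarz and cancel one factor |M^T
  y|.\<close>

lemma spectral_norm_transpose_le: "spectral_norm (transpose M) \<le> spectral_norm (M :: real^'k^'m)"
  unfolding spectral_norm_def
proof (rule onorm_le)
  fix y
  have "norm (transpose M *v y) * norm (transpose M *v y) = y \<bullet> (M *v (transpose M *v y))"
    by (simp only: power2_norm_eq_inner [symmetric] power2_eq_square [symmetric] inner_transpose_mult [symmetric])
  also have "\<dots> \<le> norm y * norm (M *v (transpose M *v y))"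
    by (rule norm_cauchy_schwarz)
  also have "\<dots> \<le> norm y * (onorm ((*v) M) * norm (transpose M *v y))"
    by (intro mult_left_mono onorm) auto
  finally have "norm (transpose M *v y) * norm (transpose M *v y) \<le>
      (onorm ((*v) M) * norm y) * norm (transpose M *v y)"
    by (simp only: ac_simps)
  then show "norm (transpose M *v y) \<le> onorm ((*v) M) * norm y"
    by (cases "transpose M *v y = 0")
      (auto simp: onorm_pos_le simp del: transpose_matrix_vector)
qed

lemma spectral_norm_transpose: "spectral_norm (transpose M) = spectral_norm (M :: real^'k^'m)"
  using spectral_norm_transpose_le [of M] spectral_norm_transpose_le [of "transpose M"] by simp

text \<open>The row types differ on purpose: the transposed Jacobian has m(n+1) rows and is compared
  with an n by n matrix.\<close>

lemma spectral_norm_eq_scaled: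
  fixes M :: "real^'k^'m" and N :: "real^'k^'p"
  assumes "0 \<le> c" and "\<And>y. norm (M *v y) = c * norm (N *v y)"
  shows "spectral_norm M = c * spectral_norm N"
proof -
  have "spectral_norm M = onorm (\<lambda>y. c *\<^sub>R (N *v y))"
    using assms by (simp add: spectral_norm_def onorm_def)
  also have "\<dots> = c * spectral_norm N"
    using assms(1) by (simp add: onorm_scaleR spectral_norm_def)
  finally show ?thesis .
qed

lemma inner_data_gram:
  "y \<bullet> (data_gram z *v w) =
    (mat_part z *v y) \<bullet> (mat_part z *v w) - min_eigenvalue z * (y \<bullet> w)"
  unfolding data_gram_mult inner_diff_right inner_scaleR_right
  by (metis inner_commute inner_transpose_mult)

lemma norm_transpose_jacobian:
  fixes a :: "real^('n::finite \<times> 'm::finite + 'm)"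
  assumes inv: "invertible (data_gram a)" and w: "data_gram a *v w = y"
  defines "x \<equiv> tls_map a"
  shows "(norm (transpose (jacobian tls_map (at a)) *v y))\<^sup>2 = ((norm x)\<^sup>2 + 1) *
    ((norm (mat_part a *v w))\<^sup>2 + min_eigenvalue a * (norm w)\<^sup>2
      - 2 * min_eigenvalue a * (x \<bullet> w)\<^sup>2 / ((norm x)\<^sup>2 + 1))"
proof -
  define J where "J = jacobian tls_map (at a)"
  define r where "r = mat_part a *v x - rhs_part a"
  define l where "l = min_eigenvalue a"
  define N where "N = (norm x)\<^sup>2 + 1"
  define q where "q = mat_part a *v w"
  define t where "t = x \<bullet> w"
  \<comment> \<open>Collects everything that is paired with dA x - db in the derivative; the adjoint
    then sends y to the stacking of [e x^T - r w^T, -e].\<close>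
  define e where "e = (2 * t / N) *\<^sub>R r - q"
  have N: "N > 0" by (simp add: N_def add_nonneg_pos)
  have "tls_map differentiable at a"
    using has_derivative_tls_map [OF inv] by (rule differentiableI)
  then have "(tls_map has_derivative (\<lambda>d. J *v d)) (at a)"
    by (simp add: jacobian_works J_def)
  from has_derivative_unique [OF this has_derivative_tls_map [OF inv]]
  have J: "J *v d = matrix_inv (data_gram a) *v
    ((2 * (r \<bullet> (mat_part d *v x - rhs_part d)) / N) *\<^sub>R x
      - transpose (mat_part d) *v r
      - transpose (mat_part a) *v (mat_part d *v x - rhs_part d))" for d
    unfolding x_def r_def N_def by metis
  \<comment> \<open>P is symmetric, so testing against y = P w cancels the inverse.\<close>
  have adj: "(matrix_inv (data_gram a) *v u) \<bullet> y = u \<bullet> w" for u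
    unfolding w [symmetric] inner_data_gram
    using matrix_inv_mult_eq [OF inv, of u "matrix_inv (data_gram a) *v u"]
      inner_data_gram [of w a "matrix_inv (data_gram a) *v u"]
    by (simp add: inner_commute)
  have Mr: "transpose (data_matrix a) *v r = l *\<^sub>R extend x (-1)"
    using data_matrix_eigenvector [OF inv] by (simp only: data_matrix_mult_extend x_def r_def l_def)
  have "transpose (mat_part a) *v r = l *\<^sub>R x"
    using Mr by (simp add: data_matrix_def transpose_augment_mult scaleR_extend
        del: transpose_matrix_vector)
  then have rq: "r \<bullet> q = l * t"
    unfolding q_def t_def by (metis inner_scaleR_left inner_transpose_mult)
  \<comment> \<open>Since r = [A b] (x, -1), the eigenvalue equation gives |r|^2 = lambda |(x,
    -1)|^2.\<close>
  have rr: "r \<bullet> r = l * N"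
  proof -
    have "r \<bullet> r = (transpose (data_matrix a) *v r) \<bullet> extend x (-1)"
      by (simp only: inner_transpose_mult data_matrix_mult_extend r_def)
    then show ?thesis
      by (simp add: Mr inner_extend N_def power2_norm_eq_inner del: transpose_matrix_vector)
  qed
  have "d \<bullet> (transpose J *v y) = d \<bullet> vec_data (outer e x - outer r w) (- e)" for d
  proof -
    have "d \<bullet> (transpose J *v y) = (J *v d) \<bullet> y"
      by (metis inner_commute inner_transpose_mult)
    also have "\<dots> = 2 * (r \<bullet> (mat_part d *v x - rhs_part d)) / N * t
        - r \<bullet> (mat_part d *v w) - (mat_part d *v x - rhs_part d) \<bullet> q"
      unfolding J adj inner_diff_left inner_scaleR_left inner_transpose_mult q_def t_def ..
    also have "\<dots> = e \<bullet> (mat_part d *v x - rhs_part d) - r \<bullet> (mat_part d *v w)"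
      by (simp add: e_def inner_diff_left inner_commute [of _ q])
    also have "\<dots> = d \<bullet> vec_data (outer e x - outer r w) (- e)"
      by (simp add: inner_vec_data inner_diff_right inner_outer inner_commute)
    finally show ?thesis .
  qed
  then have "transpose J *v y = vec_data (outer e x - outer r w) (- e)"
    using vector_eq_ldot by blast
  then have "(norm (transpose J *v y))\<^sup>2 =
      (outer e x - outer r w) \<bullet> (outer e x - outer r w) + e \<bullet> e"
    by (simp only: power2_norm_eq_inner inner_vec_data mat_part_vec_data rhs_part_vec_data
        inner_minus_left inner_minus_right minus_minus)
  also have "\<dots> = N * (e \<bullet> e) + (r \<bullet> r) * (w \<bullet> w) - 2 * (e \<bullet> r) * t"
    by (simp add: inner_diff_left inner_diff_right inner_outer outer_mult matrix_vector_mult_diff_rdistrib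
        N_def t_def power2_norm_eq_inner inner_commute algebra_simps)
  also have "N * (e \<bullet> e) = N * (q \<bullet> q) + 4 * t\<^sup>2 * (r \<bullet> r) / N - 4 * t * (r \<bullet> q)"
    using N by (simp add: e_def inner_diff_left inner_diff_right inner_commute field_simps power2_eq_square)
  also have "e \<bullet> r = 2 * t / N * (r \<bullet> r) - r \<bullet> q"
    by (simp add: e_def inner_diff_left inner_commute [of q])
  finally have "(norm (transpose J *v y))\<^sup>2 = N * (q \<bullet> q) + 4 * t\<^sup>2 * (r \<bullet> r) / N - 4 * t * (r \<bullet> q)
      + (r \<bullet> r) * (w \<bullet> w) - 2 * (2 * t / N * (r \<bullet> r) - r \<bullet> q) * t" .
  \<comment> \<open>The multiples of l t^2 are 4, -4 and -2, which leave -2.\<close>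
  also have "\<dots> = N * (q \<bullet> q + l * (w \<bullet> w) - 2 * l * t\<^sup>2 / N)"
    unfolding rq rr using N by (simp add: power2_eq_square field_simps)
  finally show ?thesis
    by (simp only: J_def N_def l_def q_def t_def power2_norm_eq_inner)
qed

section \<open>Expansions in the basis of right singular vectors\<close>

lemma diag_matrix_mult_nth: "(diag_matrix d *v y) $ i = d i * y $ i"
  by (simp add: diag_matrix_def matrix_vector_mult_def if_distrib if_distribR cong: if_cong)

lemma transpose_diag_matrix: "transpose (diag_matrix d) = diag_matrix d"
  by (simp add: transpose_def diag_matrix_def vec_eq_iff)

context
  fixes M :: "real^('n::{finite,linorder} option)^'m" and U \<sigma> V
  assumes svd: "thin_svd M U \<sigma> V"
begin

text \<open>U preserves inner products because its columns are orthonormal; V is square, so V V^T =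
  I as well and coordinates with respect to its columns are isometric.\<close>

lemma svd_inner:
  shows "(M *v u) \<bullet> (M *v v) = (\<Sum>k\<in>UNIV. (\<sigma> k)\<^sup>2 * ((transpose V *v u) $ k * (transpose V *v v) $ k))"
    and "u \<bullet> v = (\<Sum>k\<in>UNIV. (transpose V *v u) $ k * (transpose V *v v) $ k)"
proof -
  have U: "transpose U ** U = mat 1" and V: "transpose V ** V = mat 1"
    and M: "M = U ** diag_matrix \<sigma> ** transpose V"
    using svd by (simp_all add: thin_svd_def)
  have Uiso: "(U *v c) \<bullet> (U *v d) = c \<bullet> d" for c d
    by (metis U gram_mult inner_transpose_mult matrix_vector_mul_lid)
  have "M *v u = U *v (diag_matrix \<sigma> *v (transpose V *v u))" for u
    by (simp only: M matrix_vector_mul_assoc matrix_mul_assoc)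
  then have "(M *v u) \<bullet> (M *v v) =
      (diag_matrix \<sigma> *v (transpose V *v u)) \<bullet> (diag_matrix \<sigma> *v (transpose V *v v))"
    by (simp only: Uiso)
  then show "(M *v u) \<bullet> (M *v v) =
      (\<Sum>k\<in>UNIV. (\<sigma> k)\<^sup>2 * ((transpose V *v u) $ k * (transpose V *v v) $ k))"
    by (simp add: inner_vec_def diag_matrix_mult_nth power2_eq_square ac_simps
        del: transpose_matrix_vector)
  have "V ** transpose V = mat 1"
    using V matrix_left_right_inverse by blast
  then have "u \<bullet> v = (transpose V *v u) \<bullet> (transpose V *v v)"
    by (metis inner_transpose_mult matrix_vector_mul_assoc matrix_vector_mul_lid)
  then show "u \<bullet> v = (\<Sum>k\<in>UNIV. (transpose V *v u) $ k * (transpose V *v v) $ k)"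
    by (simp add: inner_vec_def del: transpose_matrix_vector)
qed

lemma svd_last_column:
  shows "norm (column None V) = 1" and "norm (M *v column None V) = \<sigma> None"
    and "(transpose V *v u) $ None = column None V \<bullet> u"
proof -
  have V: "transpose V ** V = mat 1" and \<sigma>: "0 \<le> \<sigma> None"
    using svd by (simp_all add: thin_svd_def)
  have VN: "transpose V *v column None V = axis None 1"
    by (metis V matrix_vector_mul_assoc matrix_vector_mul_lid matrix_vector_mult_basis)
  have "(norm (column None V))\<^sup>2 = 1" "(norm (M *v column None V))\<^sup>2 = (\<sigma> None)\<^sup>2"
    unfolding power2_norm_eq_inner svd_inner VN by (simp_all add: axis_def if_distrib cong: if_cong)
  then show "norm (column None V) = 1" "norm (M *v column None V) = \<sigma> None"
    using \<sigma> by (auto intro: power2_eq_imp_eq)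
  show "(transpose V *v u) $ None = column None V \<bullet> u"
    by (simp add: matrix_vector_mul_component transpose_def column_def inner_vec_def
        del: transpose_matrix_vector)
qed

lemma svd_min_singular_value: "min_singular_value M = \<sigma> None"
proof (rule min_singular_value_eqI)
  show \<sigma>: "0 \<le> \<sigma> None" using svd by (simp add: thin_svd_def)
  show "norm (M *v column None V) \<le> \<sigma> None * norm (column None V)" "column None V \<noteq> 0"
    using svd_last_column by auto
  fix w
  have "\<sigma> None \<le> \<sigma> k" for k
    using svd by (cases k) (auto simp: thin_svd_def)
  then have "(\<sigma> None * norm w)\<^sup>2 \<le> (norm (M *v w))\<^sup>2"
    unfolding power_mult_distrib power2_norm_eq_inner svd_inner sum_distrib_left
    using \<sigma> by (intro sum_mono mult_right_mono power_mono) auto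
  then show "\<sigma> None * norm w \<le> norm (M *v w)"
    by (rule power2_le_imp_le) simp
qed

end

text \<open>The origin of V11: padding w with a zero removes the last row of V, so all but the last
  coordinate of (w, 0) in the singular basis form V11^T w.\<close>

lemma transpose_mult_extend_0:
  "(transpose V *v extend w 0) $ Some i = (transpose (leading_block V) *v w) $ i"
  by (simp add: matrix_vector_mult_def transpose_def leading_block_def sum_UNIV_option
      del: transpose_matrix_vector)

theorem theorem5:
  fixes A :: "real^'n::{finite,linorder}^'m" and b :: "real^'m" and x :: "real^'n::{finite,linorder}"
    and U :: "real^('n option)^'m" and V :: "real^('n option)^('n option)"
    and \<sigma> :: "'n option \<Rightarrow> real" and s :: "'n \<Rightarrow> real"
  assumes "CARD('m) > CARD('n)"
    and "0 < min_singular_value (augment A b)"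
    and "min_singular_value (augment A b) < min_singular_value A"
    and "tls_solution A b x"
    and "thin_svd (augment A b) U \<sigma> V"
    and "\<And>i. s i = sqrt ((\<sigma> (Some i))\<^sup>2 + (\<sigma> None)\<^sup>2) / ((\<sigma> (Some i))\<^sup>2 - (\<sigma> None)\<^sup>2)"
  shows "tls_map differentiable (at (vec_data A b)) \<and>
         invertible (leading_block V) \<and>
         tls_cond A b =
           sqrt ((norm x)\<^sup>2 + 1) *
           spectral_norm (transpose (matrix_inv (leading_block V)) ** diag_matrix s)"
proof -
  define a where "a = vec_data A b"
  define W where "W = leading_block V"
  define l where "l = (\<sigma> None)\<^sup>2"
  define \<delta> where "\<delta> i = (\<sigma> (Some i))\<^sup>2 - l" for i
  note svd = assms(5)
  have inv0: "invertible (shifted_gram A b)"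
    by (rule shifted_gram_invertible [OF assms(3)])
  then have inv: "invertible (data_gram a)"
    by (simp add: data_gram_def a_def)
  have x: "tls_map a = x"
    using tls_solution_eq_formula [OF inv0 assms(4)] by (simp add: tls_map_def a_def)
  have l: "min_eigenvalue a = l"
    by (simp add: min_eigenvalue_def data_matrix_def a_def svd_min_singular_value [OF svd] l_def)
  define N where "N = (norm x)\<^sup>2 + 1"
  have N: "N > 0" by (simp add: N_def add_nonneg_pos)
  obtain \<alpha> where \<alpha>: "column None V = \<alpha> *\<^sub>R extend x (-1)"
  proof -
    have "(transpose (augment A b) ** augment A b) *v column None V =
        (min_singular_value (augment A b))\<^sup>2 *\<^sub>R column None V"
      by (rule minimizer_imp_eigenvector [OF min_singular_value_nonneg min_singular_value_le])
        (simp add: svd_last_column [OF svd] svd_min_singular_value [OF svd])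
    moreover have "column None V \<noteq> 0" using svd_last_column(1) [OF svd] by auto
    ultimately show ?thesis
      using eigenvector_augment [OF inv0] that x by (auto simp: tls_map_def a_def)
  qed
  have "(norm (column None V))\<^sup>2 = \<alpha>\<^sup>2 * N"
    unfolding \<alpha> by (simp add: power_mult_distrib norm_extend_power2 N_def)
  then have \<alpha>2: "\<alpha>\<^sup>2 * N = 1"
    by (simp add: svd_last_column [OF svd])
  have last: "(transpose V *v extend w 0) $ None = \<alpha> * (x \<bullet> w)" for w
    by (simp only: svd_last_column(3) [OF svd] \<alpha>) (simp add: inner_extend)
  have Aw: "mat_part a *v w = augment A b *v extend w 0" for w
    by (simp add: a_def augment_mult_extend)
  \<comment> \<open>A w is [A b] (w, 0); the index \<open>None\<close> is split off, where the
    coordinate of (w, 0) is v_(n+1) \<bullet> (w, 0) = \<open>\<alpha>\<close> (x \<bullet>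
    w).\<close>
  have inner_A: "(mat_part a *v y) \<bullet> (mat_part a *v w) = l * (\<alpha> * (x \<bullet> y)) * (\<alpha> * (x \<bullet> w))
      + (\<Sum>i\<in>UNIV. (\<sigma> (Some i))\<^sup>2 * ((transpose W *v y) $ i * (transpose W *v w) $ i))" for y w
    unfolding Aw svd_inner(1) [OF svd] sum_UNIV_option last transpose_mult_extend_0 W_def l_def by simp
  have inner_I: "y \<bullet> w = \<alpha> * (x \<bullet> y) * (\<alpha> * (x \<bullet> w))
      + (\<Sum>i\<in>UNIV. (transpose W *v y) $ i * (transpose W *v w) $ i)" for y w
  proof -
    have "y \<bullet> w = extend y 0 \<bullet> extend w 0" by (simp add: inner_extend)
    then show ?thesis
      by (simp only: svd_inner(2) [OF svd] sum_UNIV_option last transpose_mult_extend_0 W_def)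
  qed
  \<comment> \<open>Subtracting l times the expansion of the identity from that of A^T A cancels the
    terms of v_(n+1), whose squared singular value is l.\<close>
  have P: "data_gram a *v w = W *v (diag_matrix \<delta> *v (transpose W *v w))" for w
  proof -
    have "y \<bullet> (data_gram a *v w) = y \<bullet> (W *v (diag_matrix \<delta> *v (transpose W *v w)))" for y
    proof -
      have "y \<bullet> (data_gram a *v w) = (\<Sum>i\<in>UNIV. (\<sigma> (Some i))\<^sup>2 * ((transpose W *v y) $ i * (transpose W *v w) $ i))
          - l * (\<Sum>i\<in>UNIV. (transpose W *v y) $ i * (transpose W *v w) $ i)"
        unfolding inner_data_gram l inner_A inner_I [of y w] by (simp add: algebra_simps)
      also have "\<dots> = (transpose W *v y) \<bullet> (diag_matrix \<delta> *v (transpose W *v w))"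
        by (simp add: inner_vec_def diag_matrix_mult_nth \<delta>_def sum_distrib_left
            sum_subtractf [symmetric] algebra_simps del: transpose_matrix_vector)
      also have "\<dots> = y \<bullet> (W *v (diag_matrix \<delta> *v (transpose W *v w)))"
        by (rule inner_transpose_mult)
      finally show ?thesis .
    qed
    then show ?thesis using vector_eq_ldot by blast
  qed
  have invT: "invertible (transpose W)"
    unfolding invertible_iff_ker
  proof (intro allI impI)
    fix w assume "transpose W *v w = 0"
    then have "data_gram a *v w = 0" by (simp add: P del: transpose_matrix_vector)
    then show "w = 0" using inv unfolding invertible_iff_ker by blast
  qed
  then have invW: "invertible W"
    using transpose_invertible by fastforce
  \<comment> \<open>If \<open>\<delta> i\<close> were 0, P would annihilate the nonzero vector
    V11^(-T) e_i. This keeps the denominators of s nonzero.\<close>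
  have \<delta>: "\<delta> i \<noteq> 0" for i
  proof
    assume "\<delta> i = 0"
    define w where "w = matrix_inv (transpose W) *v axis i 1"
    have w: "transpose W *v w = axis i 1"
      using matrix_inv_mult_eq [OF invT] w_def by blast
    have "diag_matrix \<delta> *v axis i 1 = 0"
      using \<open>\<delta> i = 0\<close> by (simp add: vec_eq_iff diag_matrix_mult_nth axis_def)
    then have "data_gram a *v w = 0" unfolding P w by simp
    then have "w = 0" using inv unfolding invertible_iff_ker by blast
    then show False using w by (simp add: axis_eq_0_iff del: transpose_matrix_vector)
  qed
  define J where "J = jacobian tls_map (at a)"
  have "norm (transpose J *v y) = sqrt N * norm ((diag_matrix s ** matrix_inv W) *v y)" for y
  proof -
    define w where "w = matrix_inv (data_gram a) *v y"
    have w: "data_gram a *v w = y"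
      using matrix_inv_mult_eq [OF inv] w_def by blast
    then have "matrix_inv W *v y = diag_matrix \<delta> *v (transpose W *v w)"
      unfolding matrix_inv_mult_eq [OF invW] P by simp
    then have Sy: "((diag_matrix s ** matrix_inv W) *v y) $ i = s i * (\<delta> i * (transpose W *v w) $ i)" for i
      by (simp add: matrix_vector_mul_assoc [symmetric] diag_matrix_mult_nth del: transpose_matrix_vector)
    have "s i * \<delta> i = sqrt ((\<sigma> (Some i))\<^sup>2 + l)" for i
      using \<delta> [of i] unfolding assms(6) \<delta>_def l_def by simp
    then have Sy': "((diag_matrix s ** matrix_inv W) *v y) $ i = sqrt ((\<sigma> (Some i))\<^sup>2 + l) * (transpose W *v w) $ i" for i
      unfolding Sy by (metis mult.assoc)
    have "0 \<le> l" by (simp add: l_def)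
    have "(norm (transpose J *v y))\<^sup>2 = N * ((norm (mat_part a *v w))\<^sup>2 + l * (norm w)\<^sup>2 - 2 * l * (x \<bullet> w)\<^sup>2 / N)"
      unfolding J_def norm_transpose_jacobian [OF inv w] x l N_def ..
    \<comment> \<open>Dividing by N is multiplying by \<open>\<alpha>\<^sup>2\<close>, which exposes
      the squared coordinate of (w, 0) along v_(n+1).\<close>
    also have "2 * l * (x \<bullet> w)\<^sup>2 / N = 2 * l * (\<alpha> * (x \<bullet> w)) * (\<alpha> * (x \<bullet> w))"
    proof -
      have "2 * l * (x \<bullet> w)\<^sup>2 = 2 * l * (x \<bullet> w)\<^sup>2 * (\<alpha>\<^sup>2 * N)" by (simp add: \<alpha>2)
      then show ?thesis using N by (simp add: field_simps power2_eq_square)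
    qed
    \<comment> \<open>Along v_(n+1) the norms |A w|^2 and l |w|^2 contribute l times the same
      squared coordinate each; the subtracted term removes both.\<close>
    also have "(norm (mat_part a *v w))\<^sup>2 + l * (norm w)\<^sup>2 - 2 * l * (\<alpha> * (x \<bullet> w)) * (\<alpha> * (x \<bullet> w)) =
        (\<Sum>i\<in>UNIV. ((\<sigma> (Some i))\<^sup>2 + l) * ((transpose W *v w) $ i)\<^sup>2)"
      unfolding power2_norm_eq_inner inner_A inner_I [of w w]
      by (simp add: algebra_simps power2_eq_square sum_distrib_left sum.distrib del: transpose_matrix_vector)
    also have "\<dots> = (norm ((diag_matrix s ** matrix_inv W) *v y))\<^sup>2"
      unfolding power2_norm_eq_inner inner_vec_def Sy' using \<open>0 \<le> l\<close>
      by (simp add: power2_eq_square [symmetric] power_mult_distrib del: transpose_matrix_vector)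
    also have "N * \<dots> = (sqrt N * norm ((diag_matrix s ** matrix_inv W) *v y))\<^sup>2"
      using N by (simp add: power_mult_distrib)
    finally show ?thesis
      using N by (simp add: power2_eq_iff_nonneg del: transpose_matrix_vector)
  qed
  then have "spectral_norm (transpose J) = sqrt N * spectral_norm (diag_matrix s ** matrix_inv W)"
    using N by (intro spectral_norm_eq_scaled) auto
  moreover have "diag_matrix s ** matrix_inv W = transpose (transpose (matrix_inv W) ** diag_matrix s)"
    by (simp add: matrix_transpose_mul transpose_diag_matrix)
  ultimately have "tls_cond A b = sqrt N * spectral_norm (transpose (matrix_inv W) ** diag_matrix s)"
    unfolding tls_cond_def by (simp only: spectral_norm_transpose J_def a_def)
  moreover have "tls_map differentiable at a"
    using has_derivative_tls_map [OF inv] by (rule differentiableI)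
  ultimately show ?thesis
    using invW by (simp add: N_def W_def a_def)
qed

end
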